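(* Every core graph on exactly $7$ vertices (in particular every indecomposable one) is projective.
   Context: Graphs are finite, simple, undirected, loopless. $H$ is a core if every homomorphism $H\to H$ is bijective. A polymorphism $f:V_H^m\to V_H$ is a homomorphism from the $m$-fold direct (cross) product $H^m$ to $H$; it is idempotent if $f(x,\dots,x)=x$. $H$ is projective if every idempotent polymorphism is a projection. $H$ is decomposable if it is isomorphic to a direct product $H_1\times H_2$ of graphs each with more than one vertex, and indecomposable otherwise. *)

theory Defs
  imports "Graph_Theory.Graph_Theory"
begin

definition graph_hom ::
    "'a pair_pre_digraph \<Rightarrow> 'b pair_pre_digraph \<Rightarrow> ('a \<Rightarrow> 'b) \<Rightarrow> bool" where
  "graph_hom G H f \<longleftrightarrow>
     (\<forall>u \<in> pverts G. f u \<in> pverts H) \<and>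
     (\<forall>u v. (u, v) \<in> parcs G \<longrightarrow> (f u, f v) \<in> parcs H)"

definition is_core :: "'a pair_pre_digraph \<Rightarrow> bool" where
  "is_core H \<longleftrightarrow> (\<forall>f. graph_hom H H f \<longrightarrow> bij_betw f (pverts H) (pverts H))"

text \<open>An \<open>m\<close>-tuple of vertices is a list of length \<open>m\<close>.\<close>

definition direct_power :: "'a pair_pre_digraph \<Rightarrow> nat \<Rightarrow> 'a list pair_pre_digraph" where
  "direct_power H m =
     \<lparr> pverts = {xs. length xs = m \<and> set xs \<subseteq> pverts H},
       parcs = {(xs, ys). length xs = m \<and> length ys = m \<and>
                          (\<forall>i < m. (xs ! i, ys ! i) \<in> parcs H)} \<rparr>"

definition polymorphism :: "'a pair_pre_digraph \<Rightarrow> nat \<Rightarrow> ('a list \<Rightarrow> 'a) \<Rightarrow> bool" where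
  "polymorphism H m f \<longleftrightarrow> graph_hom (direct_power H m) H f"

definition idempotent_op :: "'a pair_pre_digraph \<Rightarrow> nat \<Rightarrow> ('a list \<Rightarrow> 'a) \<Rightarrow> bool" where
  "idempotent_op H m f \<longleftrightarrow> (\<forall>x \<in> pverts H. f (replicate m x) = x)"

text \<open>Functions are only constrained on tuples of vertices, so agreement with a coordinate
  projection is required there and nowhere else.\<close>

definition is_projection :: "'a pair_pre_digraph \<Rightarrow> nat \<Rightarrow> ('a list \<Rightarrow> 'a) \<Rightarrow> bool" where
  "is_projection H m f \<longleftrightarrow>
     (\<exists>i < m. \<forall>xs \<in> pverts (direct_power H m). f xs = xs ! i)"

definition projective :: "'a pair_pre_digraph \<Rightarrow> bool" where
  "projective H \<longleftrightarrow>
     (\<forall>m \<ge> 1. \<forall>f. polymorphism H m f \<and> idempotent_op H m f \<longrightarrow> is_projection H m f)"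

end

theory Submission
  imports Defs
begin

text \<open>
  Up to isomorphism there are exactly ten cores on seven vertices. By Ramsey, a graph on seven
  vertices contains an independent triple or, failing that, a clique triple; the other four
  vertices span one of eleven graphs, and the three rows joining the triple to them may be ordered.
  Each of the remaining labelled graphs either has a non-injective endomorphism from a short list
  or is a relabelling of one of the ten.

  For each of the ten graphs projectivity follows by arc consistency: if every \<open>x\<^sub>j\<close> has a
  neighbour among the possible values of \<open>y\<^sub>j\<close>, then \<open>F x\<close> is adjacent to some possible value of
  \<open>F y\<close>. For a suitable pair \<open>a \<noteq> b\<close>, let \<open>U\<close> be the family of all sets \<open>S\<close> of coordinates such
  that \<open>F\<close> is \<open>a\<close> on the tuple that is \<open>a\<close> on \<open>S\<close> and \<open>b\<close> elsewhere. Two arc consistency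
  refutations show that no two disjoint sets belong to \<open>U\<close> and that in every partition into three
  parts one part does. So \<open>U\<close> is a principal ultrafilter, given by a coordinate \<open>i\<close>, and a third
  arc consistency run propagates \<open>F x = x\<^sub>i\<close> from tuples over \<open>{a, b}\<close> to all tuples.
\<close>

section \<open>Graphs on seven labelled vertices\<close>

datatype vertex = V0 | V1 | V2 | V3 | V4 | V5 | V6

datatype 'a row = Row 'a 'a 'a 'a 'a 'a 'a

fun entry :: "'a row \<Rightarrow> vertex \<Rightarrow> 'a" where
  "entry (Row a b c d e f g) V0 = a"
| "entry (Row a b c d e f g) V1 = b"
| "entry (Row a b c d e f g) V2 = c"
| "entry (Row a b c d e f g) V3 = d"
| "entry (Row a b c d e f g) V4 = e"
| "entry (Row a b c d e f g) V5 = f"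
| "entry (Row a b c d e f g) V6 = g"

type_synonym matrix = "bool row row"

definition adj :: "matrix \<Rightarrow> vertex \<Rightarrow> vertex \<Rightarrow> bool" where
  "adj g x y \<longleftrightarrow> entry (entry g x) y"

definition vertices :: "vertex list" where
  "vertices = [V0, V1, V2, V3, V4, V5, V6]"

section \<open>Projectivity by arc consistency\<close>

text \<open>
  Relative to a colouring \<open>c\<close> of the coordinates, a fact \<open>(Ds, Y)\<close> says that \<open>F xs\<close> lies in \<open>Y\<close>
  as soon as every coordinate \<open>xs ! j\<close> lies in \<open>Ds ! c j\<close>; see \<open>holds\<close> below.
\<close>

type_synonym fact = "vertex list list \<times> vertex list"
type_synonym certificate = "vertex \<times> vertex \<times> fact list \<times> fact list \<times> fact list"

definition covered :: "matrix \<Rightarrow> vertex list list \<Rightarrow> vertex list list \<Rightarrow> bool" where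
  "covered g Ds Ds' \<longleftrightarrow> list_all2 (\<lambda>D D'. list_all (\<lambda>x. list_ex (adj g x) D') D) Ds Ds'"

definition refined :: "vertex list list \<Rightarrow> vertex list list \<Rightarrow> bool" where
  "refined Ds Ds' \<longleftrightarrow> list_all2 (\<lambda>D D'. list_all (\<lambda>x. x \<in> set D') D) Ds Ds'"

text \<open>A value \<open>v\<close> can be struck off in two ways: it has no neighbour among the
  values allowed on a tuple adjacent to \<open>xs\<close>, or a larger box already excludes it.
  Different values may be struck off by different facts of \<open>\<Gamma>\<close>.\<close>

definition derivable :: "matrix \<Rightarrow> fact list \<Rightarrow> fact \<Rightarrow> bool" where
  "derivable g \<Gamma> = (\<lambda>(Ds, Y). list_all (\<lambda>v. v \<in> set Y \<or>
     list_ex (\<lambda>(Ds', Y'). covered g Ds Ds' \<and> list_all (\<lambda>z. \<not> adj g v z) Y' \<or>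
                          refined Ds Ds' \<and> v \<notin> set Y') \<Gamma>) vertices)"

fun deduction :: "matrix \<Rightarrow> fact list \<Rightarrow> fact list \<Rightarrow> bool" where
  "deduction g \<Gamma> [] \<longleftrightarrow> True"
| "deduction g \<Gamma> (s # ss) \<longleftrightarrow> derivable g \<Gamma> s \<and> deduction g (s # \<Gamma>) ss"

text \<open>Nonempty lists ensure that some tuple fits the fact, and no value is left for
  it.\<close>

definition refuted :: "fact list \<Rightarrow> bool" where
  "refuted ss \<longleftrightarrow> list_ex (\<lambda>(Ds, Y). Y = [] \<and>
     (case Ds of [D0, D1, D2] \<Rightarrow> D0 \<noteq> [] \<and> D1 \<noteq> [] \<and> D2 \<noteq> [] | _ \<Rightarrow> False)) ss"

text \<open>
  The colours are \<open>S\<close>, \<open>T\<close> and the rest for \<open>ss\<close> and \<open>ts\<close>, which refute \<open>S, T \<in> U\<close> and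
  \<open>S, T, - (S \<union> T) \<notin> U\<close>; for \<open>us\<close> they are \<open>{i}\<close> and the rest.
\<close>

definition certified :: "matrix \<Rightarrow> certificate \<Rightarrow> bool" where
  "certified g = (\<lambda>(a, b, ss, ts, us). a \<noteq> b \<and>
     deduction g (([[a], [b], [b]], [a]) # ([[b], [a], [b]], [a]) #
       map (\<lambda>v. ([[v], [v], [v]], [v])) vertices) ss \<and> refuted ss \<and>
     deduction g (map (\<lambda>Ds. (Ds, filter (\<lambda>v. v \<noteq> a) vertices))
         [[[a], [b], [b]], [[b], [a], [b]], [[b], [b], [a]]] @
       map (\<lambda>v. ([[v], [v], [v]], [v])) vertices) ts \<and> refuted ts \<and>
     deduction g (([[a], [a, b]], [a]) # ([[b], [a, b]], filter (\<lambda>v. v \<noteq> a) vertices) #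
       map (\<lambda>v. ([[v], [v]], [v])) vertices) us \<and>
     list_all (\<lambda>v. ([[v], vertices], [v]) \<in> set us) vertices)"

section \<open>Soundness of arc consistency deductions\<close>

definition idempotent_polymorphism :: "matrix \<Rightarrow> nat \<Rightarrow> (vertex list \<Rightarrow> vertex) \<Rightarrow> bool" where
  "idempotent_polymorphism g m F \<longleftrightarrow>
     (\<forall>xs ys. length xs = m \<longrightarrow> length ys = m \<longrightarrow> (\<forall>j<m. adj g (xs ! j) (ys ! j)) \<longrightarrow>
        adj g (F xs) (F ys)) \<and>
     (\<forall>v. F (replicate m v) = v)"

definition holds :: "nat \<Rightarrow> (vertex list \<Rightarrow> vertex) \<Rightarrow> (nat \<Rightarrow> nat) \<Rightarrow> fact \<Rightarrow> bool" where
  "holds m F c = (\<lambda>(Ds, Y). (\<forall>j<m. c j < length Ds) \<longrightarrow>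
     (\<forall>xs. length xs = m \<longrightarrow> (\<forall>j<m. xs ! j \<in> set (Ds ! c j)) \<longrightarrow> F xs \<in> set Y))"

lemma holdsD:
  assumes "holds m F c (Ds, Y)" "\<And>j. j < m \<Longrightarrow> c j < length Ds" "length xs = m"
    "\<And>j. j < m \<Longrightarrow> xs ! j \<in> set (Ds ! c j)"
  shows "F xs \<in> set Y"
  using assms unfolding holds_def by simp

lemma in_vertices [simp]: "v \<in> set vertices"
  by (cases v) (simp_all add: vertices_def)

lemma derivable_sound:
  assumes F: "idempotent_polymorphism g m F"
    and \<Gamma>: "\<forall>s \<in> set \<Gamma>. holds m F c s"
    and s: "derivable g \<Gamma> s"
  shows "holds m F c s"
proof -
  obtain Ds Y where s_eq: "s = (Ds, Y)" by (cases s)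
  show ?thesis unfolding s_eq holds_def prod.case
  proof (intro impI allI, rule ccontr)
    fix xs
    assume c: "\<forall>j<m. c j < length Ds" and xs: "length xs = m" "\<forall>j<m. xs ! j \<in> set (Ds ! c j)"
      and notin: "F xs \<notin> set Y"
    \<comment> \<open>The vertex \<open>F xs\<close> lies outside \<open>Y\<close>, so some fact in
      \<open>\<Gamma>\<close> strikes it off.\<close>
    from s notin obtain Ds' Y' where D: "(Ds', Y') \<in> set \<Gamma>"
      and alt: "covered g Ds Ds' \<and> (\<forall>z \<in> set Y'. \<not> adj g (F xs) z) \<or>
        refined Ds Ds' \<and> F xs \<notin> set Y'"
      unfolding s_eq derivable_def
      by (fastforce simp: list_all_iff list_ex_iff)
    have H: "holds m F c (Ds', Y')" using \<Gamma> D by blast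
    from alt show False
    proof
      assume *: "covered g Ds Ds' \<and> (\<forall>z \<in> set Y'. \<not> adj g (F xs) z)"
      have len: "length Ds = length Ds'" using * by (auto simp: covered_def dest: list_all2_lengthD)
      \<comment> \<open>Neighbours chosen coordinate by coordinate form a tuple in the box
        \<open>Ds'\<close> that is adjacent to \<open>xs\<close> in the power.\<close>
      have "\<forall>j\<in>{..<m}. \<exists>y. y \<in> set (Ds' ! c j) \<and> adj g (xs ! j) y"
        using * c xs unfolding covered_def list_all2_conv_all_nth list_all_iff list_ex_iff
        by (metis lessThan_iff)
      then obtain y where y: "\<forall>j\<in>{..<m}. y j \<in> set (Ds' ! c j) \<and> adj g (xs ! j) (y j)"
        by metis
      have "F (map y [0..<m]) \<in> set Y'"
        using H c y len by (auto simp: holds_def)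
      moreover have "adj g (F xs) (F (map y [0..<m]))"
        using F y xs by (auto simp: idempotent_polymorphism_def)
      ultimately show False using * by blast
    next
      assume *: "refined Ds Ds' \<and> F xs \<notin> set Y'"
      have len: "length Ds = length Ds'" using * by (auto simp: refined_def dest: list_all2_lengthD)
      have "\<forall>j<m. xs ! j \<in> set (Ds' ! c j)"
        using * c xs by (auto simp: refined_def list_all2_conv_all_nth list_all_iff)
      then show False using H * c xs len by (auto simp: holds_def)
    qed
  qed
qed

lemma deduction_sound:
  assumes F: "idempotent_polymorphism g m F"
    and "\<forall>s \<in> set \<Gamma>. holds m F c s" and "deduction g \<Gamma> ss"
  shows "\<forall>s \<in> set ss. holds m F c s"
  using assms(2,3)
proof (induction ss arbitrary: \<Gamma>)
  case (Cons s ss)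
  have s: "derivable g \<Gamma> s" and ss: "deduction g (s # \<Gamma>) ss" using Cons.prems(2) by simp_all
  have "holds m F c s" by (rule derivable_sound[OF F Cons.prems(1) s])
  then have "\<forall>s \<in> set (s # \<Gamma>). holds m F c s" using Cons.prems(1) by simp
  from Cons.IH[OF this ss] \<open>holds m F c s\<close> show ?case by simp
qed simp

lemma not_refuted:
  assumes c: "\<forall>j. c j < 3" and ss: "\<forall>s \<in> set ss. holds m F c s"
  shows "\<not> refuted ss"
proof
  assume "refuted ss"
  then obtain D0 D1 D2 where D: "([D0, D1, D2], []) \<in> set ss" "D0 \<noteq> []" "D1 \<noteq> []" "D2 \<noteq> []"
    unfolding refuted_def list_ex_iff by (auto split: list.splits)
  let ?xs = "map (\<lambda>j. hd ([D0, D1, D2] ! c j)) [0..<m]"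
  have "[D0, D1, D2] ! k \<noteq> []" if "k < 3" for k
    using that D by (auto simp: less_Suc_eq numeral_3_eq_3)
  then have "F ?xs \<in> set []"
    using holdsD[of m F c "[D0, D1, D2]" "[]" ?xs] ss D c by (simp add: numeral_3_eq_3)
  then show False by simp
qed

section \<open>Principal ultrafilters of coordinates and projections\<close>

text \<open>Take a member of least size inside \<open>A\<close> and a point \<open>i\<close> of it.
  Splitting off \<open>{i}\<close> leaves a smaller set and the complement of the member, neither of
  which belongs to \<open>U\<close>, so \<open>{i}\<close> does. Every \<open>T\<close> is then
  compared with \<open>{i}\<close>, using the partition into \<open>T\<close>, the empty set and the
  complement.\<close>

lemma principal_of_additive:
  fixes U :: "'b set \<Rightarrow> bool"
  assumes disj: "\<And>S T. S \<inter> T = {} \<Longrightarrow> \<not> (U S \<and> U T)"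
    and split: "\<And>S T. S \<inter> T = {} \<Longrightarrow> U S \<or> U T \<or> U (- (S \<union> T))"
    and A: "finite A" "U A"
  obtains i where "i \<in> A" "\<And>S. U S \<longleftrightarrow> i \<in> S"
proof -
  obtain S where S: "S \<subseteq> A" "U S" and min: "\<And>T. T \<subseteq> A \<Longrightarrow> U T \<Longrightarrow> card S \<le> card T"
    using ex_has_least_nat[of "\<lambda>S. S \<subseteq> A \<and> U S" A card] A by auto
  have fin: "finite S" using S A finite_subset by blast
  have empty: "\<not> U {}" using disj[of "{}" "{}"] by simp
  then obtain i where i: "i \<in> S" using S by (cases "S = {}") auto
  have "U {i}"
  proof (cases "S = {i}")
    case False
    have "\<not> U (S - {i})"
      using min[of "S - {i}"] card_Diff1_less[OF fin i] S by auto
    moreover have "\<not> U (- S)" using disj[of S "- S"] S by blast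
    ultimately show ?thesis using split[of "{i}" "S - {i}"] i by (auto simp: insert_absorb)
  qed (use S in simp)
  have "U T \<longleftrightarrow> i \<in> T" for T
  proof
    assume "U T"
    then show "i \<in> T" using disj[of "{i}" T] \<open>U {i}\<close> by blast
  next
    assume "i \<in> T"
    then have "\<not> U (- T)" using disj[of "{i}" "- T"] \<open>U {i}\<close> by blast
    then show "U T" using split[of T "{}"] empty by simp
  qed
  then show thesis using that i S by blast
qed

lemma certified_imp_projection:
  assumes cert: "certified g cert" and F: "idempotent_polymorphism g m F"
  obtains i where "i < m" "\<And>xs. length xs = m \<Longrightarrow> F xs = xs ! i"
proof -
  obtain a b ss ts us where cert_eq: "cert = (a, b, ss, ts, us)" by (metis prod.exhaust)
  let ?const3 = "map (\<lambda>v. ([[v], [v], [v]], [v])) vertices"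
  let ?na = "filter (\<lambda>v. v \<noteq> a) vertices"
  have ss: "deduction g (([[a], [b], [b]], [a]) # ([[b], [a], [b]], [a]) # ?const3) ss" "refuted ss"
    and ts: "deduction g (map (\<lambda>Ds. (Ds, ?na))
      [[[a], [b], [b]], [[b], [a], [b]], [[b], [b], [a]]] @ ?const3) ts" "refuted ts"
    and us: "deduction g (([[a], [a, b]], [a]) # ([[b], [a, b]], ?na) #
      map (\<lambda>v. ([[v], [v]], [v])) vertices) us"
    and us': "\<And>v. ([[v], vertices], [v]) \<in> set us" and "a \<noteq> b"
    using cert unfolding cert_eq certified_def prod.case by (auto simp: list_all_iff)
  have idem: "F (replicate m v) = v" for v using F by (simp add: idempotent_polymorphism_def)
  have const: "F xs = v" if "length xs = m" "\<forall>j<m. xs ! j = v" for xs v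
    using idem[of v] that by (metis length_replicate nth_equalityI nth_replicate)
  define X where "X S = map (\<lambda>j. if j \<in> S then a else b) [0..<m]" for S
  have X: "xs = X S" if "length xs = m" "\<forall>j<m. xs ! j = (if j \<in> S then a else b)" for xs S
    unfolding X_def using that by (intro nth_equalityI) auto
  define U where "U S \<longleftrightarrow> F (X S) = a" for S
  define c :: "nat set \<Rightarrow> nat set \<Rightarrow> nat \<Rightarrow> nat"
    where "c S T j = (if j \<in> S then 0 else if j \<in> T then 1 else 2)" for S T j
  have c3: "\<forall>j. c S T j < 3" for S T by (simp add: c_def)
  have const3: "holds m F (c S T) ([[v], [v], [v]], [v])" for S T v
    unfolding holds_def by (auto simp: c_def intro!: const split: if_splits)
  \<comment> \<open>Lists with one element leave only the tuple \<open>X P\<close>. In this form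
    \<open>U P\<close> or its negation enters a derivation.\<close>
  have holds3: "holds m F (c S T) ([[p], [q], [r]], Y)"
    if P: "\<And>j. (if j \<in> P then a else b) = (if j \<in> S then p else if j \<in> T then q else r)"
      and Y: "F (X P) \<in> set Y" for S T P p q r Y
    unfolding holds_def prod.case
  proof (intro impI allI)
    fix xs assume xs: "length xs = m" "\<forall>j<m. xs ! j \<in> set ([[p], [q], [r]] ! c S T j)"
    have "xs ! j = (if j \<in> P then a else b)" if "j < m" for j
      using xs(2)[rule_format, OF that] unfolding P by (simp add: c_def split: if_splits)
    then show "F xs \<in> set Y" using X[OF xs(1)] Y by metis
  qed
  have disj: "\<not> (U S \<and> U T)" if ST: "S \<inter> T = {}" for S T
  proof
    assume *: "U S \<and> U T"
    have "holds m F (c S T) ([[a], [b], [b]], [a])"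
      using * by (intro holds3[of S]) (auto simp: U_def)
    moreover have "holds m F (c S T) ([[b], [a], [b]], [a])"
      using * ST by (intro holds3[of T]) (auto simp: U_def)
    ultimately have "\<forall>s \<in> set ss. holds m F (c S T) s"
      using const3 by (intro deduction_sound[OF F _ ss(1)]) auto
    then show False using not_refuted[OF c3] ss(2) by blast
  qed
  have split: "U S \<or> U T \<or> U (- (S \<union> T))" if ST: "S \<inter> T = {}" for S T
  proof (rule ccontr)
    assume *: "\<not> ?thesis"
    have "holds m F (c S T) ([[a], [b], [b]], ?na)"
      using * by (intro holds3[of S]) (auto simp: U_def)
    moreover have "holds m F (c S T) ([[b], [a], [b]], ?na)"
      using * ST by (intro holds3[of T]) (auto simp: U_def)
    moreover have "holds m F (c S T) ([[b], [b], [a]], ?na)"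
      using * by (intro holds3[of "- (S \<union> T)"]) (auto simp: U_def)
    ultimately have "\<forall>s \<in> set ts. holds m F (c S T) s"
      using const3 by (intro deduction_sound[OF F _ ts(1)]) auto
    then show False using not_refuted[OF c3] ts(2) by blast
  qed
  \<comment> \<open>The tuple for the full set is constant, so idempotence supplies a first member
    of \<open>U\<close>.\<close>
  have "U {..<m}" using idem[of a] X[of "replicate m a" "{..<m}"] by (simp add: U_def)
  then obtain i where i: "i < m" and iU: "\<And>S. U S \<longleftrightarrow> i \<in> S"
    using principal_of_additive[of U "{..<m}"] disj split by auto
  define d where "d j = (if j = i then 0 else 1 :: nat)" for j
  have ab: "F xs = a \<longleftrightarrow> xs ! i = a" if "length xs = m" "\<forall>j<m. xs ! j \<in> {a, b}" for xs
  proof -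
    \<comment> \<open>Indices from \<open>m\<close> on may fall into this set, but \<open>X\<close>
      ignores them.\<close>
    have "xs = X {j. xs ! j = a}" using that by (intro X) auto
    then show ?thesis using iU[of "{j. xs ! j = a}"] by (simp add: U_def)
  qed
  have holds2: "holds m F d ([D, D'], Y)"
    if Y: "\<And>xs. length xs = m \<Longrightarrow> xs ! i \<in> set D \<Longrightarrow>
      \<forall>j<m. j \<noteq> i \<longrightarrow> xs ! j \<in> set D' \<Longrightarrow> F xs \<in> set Y"
    for D D' Y
    unfolding holds_def prod.case
  proof (intro impI allI)
    fix xs assume xs: "length xs = m" "\<forall>j<m. xs ! j \<in> set ([D, D'] ! d j)"
    have "xs ! i \<in> set D" using xs(2)[rule_format, OF i] by (simp add: d_def)
    moreover have "xs ! j \<in> set D'" if "j < m" "j \<noteq> i" for j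
      using xs(2)[rule_format, OF that(1)] that(2) by (simp add: d_def)
    ultimately show "F xs \<in> set Y" using Y xs(1) by blast
  qed
  have "holds m F d ([[a], [a, b]], [a])"
  proof (rule holds2)
    fix xs assume "length xs = m" "xs ! i \<in> set [a]" "\<forall>j<m. j \<noteq> i \<longrightarrow> xs ! j \<in> set [a, b]"
    then show "F xs \<in> set [a]" using ab[of xs] by auto
  qed
  \<comment> \<open>\<open>ab\<close> decides only whether the value is \<open>a\<close>, so the
    bound excludes \<open>a\<close> without claiming \<open>b\<close>; recovering \<open>b\<close>
    is left to \<open>us\<close>.\<close>
  moreover have "holds m F d ([[b], [a, b]], ?na)"
  proof (rule holds2)
    fix xs assume "length xs = m" "xs ! i \<in> set [b]" "\<forall>j<m. j \<noteq> i \<longrightarrow> xs ! j \<in> set [a, b]"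
    then show "F xs \<in> set ?na" using ab[of xs] \<open>a \<noteq> b\<close> by auto
  qed
  moreover have "holds m F d ([[v], [v]], [v])" for v
  proof (rule holds2)
    fix xs assume "length xs = m" "xs ! i \<in> set [v]" "\<forall>j<m. j \<noteq> i \<longrightarrow> xs ! j \<in> set [v]"
    then show "F xs \<in> set [v]" using const[of xs v] by auto
  qed
  ultimately have "\<forall>s \<in> set us. holds m F d s"
    by (intro deduction_sound[OF F _ us]) auto
  \<comment> \<open>The other coordinates range over all vertices, so the coordinate
    \<open>i\<close> alone fixes the value.\<close>
  then have "holds m F d ([[v], vertices], [v])" for v using us' by blast
  then have "F xs = xs ! i" if "length xs = m" for xs
    using holdsD[of m F d "[[xs ! i], vertices]" "[xs ! i]" xs] that by (auto simp: d_def)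
  then show thesis using that i by blast
qed

section \<open>Transfer from labelled matrices to graphs\<close>

definition represents :: "(vertex \<Rightarrow> 'a) \<Rightarrow> matrix \<Rightarrow> 'a pair_pre_digraph \<Rightarrow> bool" where
  "represents \<phi> g H \<longleftrightarrow>
     bij_betw \<phi> UNIV (pverts H) \<and> (\<forall>x y. adj g x y \<longleftrightarrow> (\<phi> x, \<phi> y) \<in> parcs H)"

text \<open>Conjugation by \<open>\<phi>\<close> turns \<open>f\<close> into an idempotent
  polymorphism on the labels, and a projection there comes back as a projection on tuples of
  vertices of \<open>H\<close>.\<close>

lemma projective_if_certified:
  fixes H :: "'a pair_pre_digraph"
  assumes rep: "represents \<phi> g H" and cert: "certified g cert"
  shows "projective H"
  unfolding projective_def
proof (intro allI impI)
  fix m :: nat and f :: "'a list \<Rightarrow> 'a"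
  assume f: "polymorphism H m f \<and> idempotent_op H m f"
  have bij: "bij_betw \<phi> UNIV (pverts H)" and adj: "\<And>x y. adj g x y \<longleftrightarrow> (\<phi> x, \<phi> y) \<in> parcs H"
    using rep by (auto simp: represents_def)
  have inj: "inj \<phi>" and ran: "range \<phi> = pverts H" using bij by (auto simp: bij_betw_def)
  have f_verts: "f ys \<in> pverts H" if "length ys = m" "set ys \<subseteq> pverts H" for ys
    using f that by (simp add: polymorphism_def graph_hom_def direct_power_def)
  have f_arcs: "(f xs, f ys) \<in> parcs H"
    if "length xs = m" "length ys = m" "\<forall>j<m. (xs ! j, ys ! j) \<in> parcs H" for xs ys
    using f that by (simp add: polymorphism_def graph_hom_def direct_power_def)
  define F where "F xs = inv \<phi> (f (map \<phi> xs))" for xs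
  have F: "\<phi> (F xs) = f (map \<phi> xs)" if "length xs = m" for xs
  proof -
    have "f (map \<phi> xs) \<in> range \<phi>"
      using f_verts[of "map \<phi> xs"] that ran by auto
    then show ?thesis by (simp add: F_def f_inv_into_f)
  qed
  have "adj g (F xs) (F ys)"
    if "length xs = m" "length ys = m" "\<forall>j<m. adj g (xs ! j) (ys ! j)" for xs ys
    using f_arcs[of "map \<phi> xs" "map \<phi> ys"] that by (simp add: adj F)
  moreover have "F (replicate m v) = v" for v
  proof -
    have "\<phi> v \<in> pverts H" using ran by blast
    then show ?thesis using f inj by (simp add: F_def idempotent_op_def map_replicate)
  qed
  ultimately have "idempotent_polymorphism g m F" by (simp add: idempotent_polymorphism_def)
  then obtain i where i: "i < m" "\<And>xs. length xs = m \<Longrightarrow> F xs = xs ! i"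
    using certified_imp_projection[OF cert] by metis
  have "f ys = ys ! i" if "length ys = m" "set ys \<subseteq> pverts H" for ys
  proof -
    have "map \<phi> (map (inv \<phi>) ys) = ys"
      using that ran by (auto simp: map_idI f_inv_into_f subset_iff)
    then show ?thesis using F[of "map (inv \<phi>) ys"] i that
      by (metis length_map nth_map)
  qed
  then show "is_projection H m f"
    unfolding is_projection_def direct_power_def using i by auto
qed

section \<open>The ten cores\<close>

text \<open>
  The heptagon, the six 4-vertex-critical graphs on seven vertices other than its complement,
  the join of an edge and a pentagon, the complement of the heptagon, and the complete graph.
\<close>

definition core0 :: matrix where
  "core0 = Row (Row False False False True True False False)
      (Row False False False False True True False)
      (Row False False False False False True True)
      (Row True False False False False False True)
      (Row True True False False False False False)
      (Row False True True False False False False)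
      (Row False False True True False False False)"

definition core1 :: matrix where
  "core1 = Row (Row False False False True True True False)
      (Row False False False True True False True)
      (Row False False False False True True True)
      (Row True True False False False True True)
      (Row True True True False False False False)
      (Row True False True True False False True)
      (Row False True True True False True False)"

definition core2 :: matrix where
  "core2 = Row (Row False False True False True True False)
      (Row False False False True False True True)
      (Row True False False False True False True)
      (Row False True False False False True True)
      (Row True False True False False False True)
      (Row True True False True False False False)
      (Row False True True True True False False)"

definition core3 :: matrix where
  "core3 = Row (Row False False True False True True True)
      (Row False False False True False True True)
      (Row True False False False True True False)
      (Row False True False False False True True)
      (Row True False True False False False True)
      (Row True True True True False False False)
      (Row True True False True True False False)"

definition core4 :: matrix where
  "core4 = Row (Row False False True False True True False)
      (Row False False False True True True True)
      (Row True False False False True False True)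
      (Row False True False False False True True)
      (Row True True True False False False True)
      (Row True True False True False False False)
      (Row False True True True True False False)"

definition core5 :: matrix where
  "core5 = Row (Row False False True False True True True)
      (Row False False False True True True True)
      (Row True False False False True True False)
      (Row False True False False False True True)
      (Row True True True False False False True)
      (Row True True True True False False False)
      (Row True True False True True False False)"

definition core6 :: matrix where
  "core6 = Row (Row False False True True False True True)
      (Row False False False True True True True)
      (Row True False False False True True False)
      (Row True True False False False True True)
      (Row False True True False False False True)
      (Row True True True True False False False)
      (Row True True False True True False False)"

definition core7 :: matrix where
  "core7 = Row (Row False False True True False True True)
      (Row False False False True True True True)
      (Row True False False False True True True)
      (Row True True False False False True True)
      (Row False True True False False True True)
      (Row True True True True True False True)
      (Row True True True True True True False)"

definition core8 :: matrix where
  "core8 = Row (Row False False True True True True False)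
      (Row False False False True True True True)
      (Row True False False False True True True)
      (Row True True False False False True True)
      (Row True True True False False False True)
      (Row True True True True False False False)
      (Row False True True True True False False)"

definition core9 :: matrix where
  "core9 = Row (Row False True True True True True True)
      (Row True False True True True True True)
      (Row True True False True True True True)
      (Row True True True False True True True)
      (Row True True True True False True True)
      (Row True True True True True False True)
      (Row True True True True True True False)"

text \<open>Every certificate starts with the pair \<open>a\<close>, \<open>b\<close>. In the three
  derivations that follow, each entry rests on the starting facts and on earlier entries; the first
  two derivations end with an empty list of values.\<close>

definition cert0 :: certificate where
  "cert0 = (V2, V3,
     [([[V0], [V6], [V6]], [V6]), ([[V6], [V0], [V0]], [V6]), ([[V2], [V4], [V4]], [V2, V3]),
      ([[V4], [V2], [V2]], [V2, V3]), ([[V1], [V5], [V5]], [V0, V5, V6]),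
      ([[V5], [V1], [V1]], [])],
     [([[V3], [V3], [V2]], [V3]), ([[V2], [V3], [V3]], [V3]), ([[V3], [V2], [V3]], [V3]),
      ([[V5], [V0], [V0]], [V0, V6]), ([[V6], [V6], [V5]], [V6]), ([[V6], [V5], [V6]], [V6]),
      ([[V2], [V2], [V1]], [V2]), ([[V5], [V6], [V4]], [V5, V6]),
      ([[V1], [V4], [V4]], [V2, V3, V4]), ([[V1], [V3], [V0]], [V1, V2, V3]),
      ([[V4], [V1], [V1]], [V0, V1, V5, V6]), ([[V0], [V5], [V5]], [V1, V2, V3, V4, V5]),
      ([[V3], [V1], [V2]], [V2]), ([[V0], [V4], [V6]], [V5, V6]), ([[V4], [V0], [V3]], [])],
     [([[V3], [V2, V3]], [V3]), ([[V5], [V0, V5, V6]], [V5, V6]), ([[V6], [V0, V5]], [V6]),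
      ([[V1], [V1, V2, V3, V4]], [V1, V2, V3]), ([[V3], [V1, V4]], [V2, V3]),
      ([[V4], [V1, V4]], [V0, V4, V5, V6]), ([[V0], [V0, V1, V4, V5]], [V0]),
      ([[V4], [V0, V1, V4, V5]], [V4]), ([[V3], [V0, V1, V2, V3, V4, V5]], [V3, V4]),
      ([[V6], [V0, V1, V4, V5, V6]], [V0, V1, V6]),
      ([[V2], [V0, V1, V4, V5]], [V2, V3, V4, V5]), ([[V1], [V0, V1, V3, V5]], [V0, V1]),
      ([[V5], [V0, V2, V4, V5]], [V5]), ([[V2], [V0, V1, V3, V4, V5]], [V2]),
      ([[V1], vertices], [V1, V2]), ([[V6], vertices], [V6]),
      ([[V3], [V0, V1, V2, V3, V4, V5]], [V3]), ([[V4], vertices], [V4, V5]),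
      ([[V0], vertices], [V0]), ([[V4], vertices], [V4]), ([[V5], vertices], [V5]),
      ([[V2], vertices], [V2]), ([[V1], vertices], [V1]), ([[V3], vertices], [V3])])"

definition cert1 :: certificate where
  "cert1 = (V3, V6,
     [([[V1], [V2], [V1]], [V1]), ([[V3], [V5], [V3]], [])],
     [([[V6], [V6], [V3]], [V6]), ([[V6], [V3], [V6]], [V6]), ([[V3], [V6], [V6]], [V6]),
      ([[V3], [V6], [V3]], [V3]), ([[V6], [V5], [V5]], [V5]), ([[V5], [V2], [V6]], [])],
     [([[V0], [V0, V3, V6]], [V0, V6]), ([[V4], [V6]], [V4]), ([[V1], [V1, V2, V3, V5]], [V1]),
      ([[V5], [V1, V2, V3, V5]], [V1, V5]), ([[V3], [V1, V3, V6]], [V3, V4]),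
      ([[V6], vertices], [V6]), ([[V4], [V1, V2, V4, V5, V6]], [V3, V4]),
      ([[V3], vertices], [V3]), ([[V2], vertices], [V2]), ([[V5], vertices], [V5]),
      ([[V4], vertices], [V4]), ([[V1], vertices], [V1]), ([[V0], vertices], [V0])])"

definition cert2 :: certificate where
  "cert2 = (V0, V6,
     [([[V3], [V5], [V3]], [V5]), ([[V5], [V3], [V1]], [])],
     [([[V6], [V6], [V0]], [V6]), ([[V6], [V0], [V6]], [V6]), ([[V0], [V6], [V6]], [V6]),
      ([[V5], [V3], [V3]], [V3]), ([[V1], [V1], [V5]], [V1]), ([[V3], [V5], [V1]], [])],
     [([[V5], [V3, V5]], [V5]), ([[V1], [V1, V5, V6]], [V1]), ([[V6], [V2]], [V6]),
      ([[V4], [V0, V4, V6]], [V4]), ([[V6], vertices], [V6]), ([[V0], [V0, V4, V6]], [V0, V6]),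
      ([[V3], vertices], [V3]), ([[V5], vertices], [V5]), ([[V2], vertices], [V2]),
      ([[V1], vertices], [V1]), ([[V0], vertices], [V0]), ([[V4], vertices], [V4])])"

definition cert3 :: certificate where
  "cert3 = (V0, V6,
     [([[V0], [V4], [V4]], [V4]), ([[V4], [V0], [V0]], [])],
     [([[V6], [V6], [V0]], [V2, V6]), ([[V0], [V6], [V6]], [V2, V6]),
      ([[V4], [V4], [V2]], [V4, V5]), ([[V6], [V0], [V6]], [V2, V6]),
      ([[V0], [V2], [V0]], [V0]), ([[V6], [V0], [V4]], [])],
     [([[V4], [V0, V1, V3, V4]], [V4]), ([[V5], [V1, V5, V6]], [V5, V6]),
      ([[V2], vertices], [V2]), ([[V3], [V3, V5, V6]], [V3]), ([[V6], vertices], [V6]),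
      ([[V0], vertices], [V0]), ([[V4], vertices], [V4]), ([[V5], vertices], [V5]),
      ([[V1], vertices], [V1]), ([[V3], vertices], [V3])])"

definition cert4 :: certificate where
  "cert4 = (V0, V1,
     [([[V4], [V6], [V4]], [V4]), ([[V6], [V4], [V6]], [])],
     [([[V1], [V0], [V1]], [V1]), ([[V1], [V1], [V0]], [V1]), ([[V0], [V1], [V1]], [V1]),
      ([[V6], [V6], [V2]], [V6]), ([[V4], [V2], [V4]], [V4]), ([[V2], [V4], [V6]], [])],
     [([[V4], [V3, V4, V6]], [V4, V5]), ([[V2], [V2, V3, V4, V5]], [V2]),
      ([[V6], [V1, V3, V4, V6]], [V0, V6]), ([[V1], [V1, V5, V6]], [V1]),
      ([[V0], [V3, V4, V5, V6]], [V0, V6]), ([[V6], vertices], [V6]), ([[V4], vertices], [V4]),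
      ([[V3], [V3, V4, V5, V6]], [V3, V4]), ([[V5], vertices], [V5]), ([[V3], vertices], [V3]),
      ([[V1], vertices], [V1]), ([[V0], vertices], [V0]), ([[V2], vertices], [V2])])"

definition cert5 :: certificate where
  "cert5 = (V1, V5,
     [([[V1], [V3], [V2]], [V3]), ([[V3], [V1], [V0]], [])],
     [([[V1], [V5], [V5]], [V5, V6]), ([[V5], [V1], [V5]], [V5, V6]),
      ([[V3], [V6], [V3]], [V3, V4]), ([[V6], [V1], [V1]], [V1]),
      ([[V1], [V3], [V5]], [V5, V6]), ([[V5], [V5], [V1]], [])],
     [([[V5], [V0, V4, V5]], [V4, V5]), ([[V0], [V0, V5]], [V0]), ([[V4], [V0, V1, V4]], [V4]),
      ([[V6], vertices], [V6]), ([[V3], vertices], [V3]), ([[V4], vertices], [V4]),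
      ([[V1], vertices], [V1]), ([[V2], [V3, V4, V6]], [V2, V6]), ([[V5], vertices], [V5]),
      ([[V2], vertices], [V2]), ([[V0], vertices], [V0])])"

definition cert6 :: certificate where
  "cert6 = (V0, V5,
     [([[V3], [V1], [V0]], [V3]), ([[V1], [V3], [V2]], [])],
     [([[V5], [V0], [V5]], [V5]), ([[V2], [V6], [V2]], [V2]), ([[V0], [V5], [V5]], [V5]),
      ([[V5], [V0], [V0]], [V0]), ([[V0], [V3], [V5]], [V5]), ([[V5], [V5], [V0]], [])],
     [([[V3], [V0, V1, V3]], [V3]), ([[V2], [V1, V2, V3]], [V2, V3]),
      ([[V6], [V0, V5, V6]], [V5, V6]), ([[V4], [V3, V4, V5, V6]], [V4]),
      ([[V2], [V0, V1, V3]], [V2]), ([[V0], vertices], [V0]), ([[V6], vertices], [V6]),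
      ([[V1], vertices], [V1]), ([[V5], vertices], [V5]), ([[V4], vertices], [V4]),
      ([[V3], vertices], [V3]), ([[V2], vertices], [V2])])"

definition cert7 :: certificate where
  "cert7 = (V2, V5,
     [([[V3], [V5], [V3]], [V5]), ([[V5], [V1], [V1]], [])],
     [([[V5], [V5], [V2]], [V5]), ([[V2], [V5], [V5]], [V5]), ([[V5], [V3], [V3]], [V3]),
      ([[V0], [V0], [V5]], [V0]), ([[V3], [V5], [V0]], [V5]), ([[V5], [V2], [V5]], [])],
     [([[V5], [V1, V2, V5]], [V5]), ([[V3], [V3, V5]], [V3]), ([[V1], [V1, V5]], [V1]),
      ([[V6], vertices], [V6]), ([[V5], vertices], [V5]), ([[V4], vertices], [V4]),
      ([[V0], vertices], [V0]), ([[V2], vertices], [V2]), ([[V3], vertices], [V3]),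
      ([[V1], vertices], [V1])])"

definition cert8 :: certificate where
  "cert8 = (V4, V3,
     [([[V0], [V5], [V0]], [V0, V6]), ([[V5], [V0], [V5]], [])],
     [([[V4], [V3], [V3]], [V3]), ([[V3], [V3], [V4]], [V3]), ([[V3], [V4], [V3]], [V3]),
      ([[V5], [V2], [V5]], [V5]), ([[V0], [V1], [V2]], [V0, V1]), ([[V2], [V6], [V0]], [])],
     [([[V2], [V2, V5]], [V2]), ([[V0], [V0, V5]], [V0, V6]),
      ([[V1], [V0, V1, V5, V6]], [V0, V1, V6]), ([[V5], [V1, V5]], [V5]),
      ([[V4], [V0, V1, V2, V3]], [V4, V5]), ([[V6], vertices], [V6]), ([[V0], vertices], [V0]),
      ([[V4], vertices], [V4]), ([[V3], [V2, V4, V5]], [V2, V3]), ([[V1], vertices], [V1]),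
      ([[V2], vertices], [V2]), ([[V3], vertices], [V3]), ([[V5], vertices], [V5])])"

text \<open>A sample reading of the first derivation, with tuples written by colour: on
  \<open>V0, V5, V0\<close> the constants leave the values \<open>V0\<close> and \<open>V5\<close>,
  and the adjacent tuple \<open>V1, V0, V1\<close>, sent to \<open>V0\<close>, strikes off
  \<open>V0\<close>. On \<open>V5, V0, V5\<close> the same two values remain;
  \<open>V0, V1, V1\<close> strikes off \<open>V0\<close> and the previous entry strikes off
  \<open>V5\<close>.\<close>

definition cert9 :: certificate where
  "cert9 = (V0, V1,
     [([[V0], [V5], [V0]], [V5]), ([[V5], [V0], [V5]], [])],
     [([[V0], [V1], [V1]], [V1]), ([[V1], [V0], [V1]], [V1]), ([[V2], [V1], [V2]], [V2]),
      ([[V1], [V1], [V0]], [V1]), ([[V0], [V0], [V1]], [V0]), ([[V1], [V2], [V0]], [])],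
     [([[V2], [V0, V2]], [V2]), ([[V4], [V0, V4]], [V4]), ([[V1], [V0, V1]], [V1]),
      ([[V3], [V0, V4]], [V3]), ([[V6], [V1, V6]], [V6]), ([[V5], vertices], [V5]),
      ([[V1], vertices], [V1]), ([[V4], vertices], [V4]), ([[V3], vertices], [V3]),
      ([[V6], vertices], [V6]), ([[V2], vertices], [V2]), ([[V0], vertices], [V0])])"

lemma certified_cores:
  "certified core0 cert0"
  "certified core1 cert1"
  "certified core2 cert2"
  "certified core3 cert3"
  "certified core4 cert4"
  "certified core5 cert5"
  "certified core6 cert6"
  "certified core7 cert7"
  "certified core8 cert8"
  "certified core9 cert9"
  by code_simp+

section \<open>Classification\<close>

definition edge_pairs :: "(vertex \<times> vertex) list" where
  "edge_pairs = [
    (V0, V1), (V0, V2), (V0, V3), (V0, V4), (V0, V5), (V0, V6), (V1, V2),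
    (V1, V3), (V1, V4), (V1, V5), (V1, V6), (V2, V3), (V2, V4), (V2, V5),
    (V2, V6), (V3, V4), (V3, V5), (V3, V6), (V4, V5), (V4, V6), (V5, V6)]"

fun row_le :: "bool row \<Rightarrow> bool row \<Rightarrow> bool" where
  "row_le (Row a b c d e f g) (Row a' b' c' d' e' f' g') \<longleftrightarrow>
     (\<not> a \<or> a') \<and> (\<not> b \<or> b') \<and> (\<not> c \<or> c') \<and> (\<not> d \<or> d') \<and>
     (\<not> e \<or> e') \<and> (\<not> f \<or> f') \<and> (\<not> g \<or> g')"

text \<open>If the neighbourhood of one vertex lies in that of another, moving the first onto the
  second and fixing the rest is a non-injective endomorphism.\<close>

definition foldable :: "matrix \<Rightarrow> bool" where
  "foldable g \<longleftrightarrow> list_ex (\<lambda>(x, y).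
     row_le (entry g x) (entry g y) \<or> row_le (entry g y) (entry g x)) edge_pairs"

definition is_endo :: "matrix \<Rightarrow> vertex row \<Rightarrow> bool" where
  "is_endo g h \<longleftrightarrow> list_all (\<lambda>(x, y). \<not> adj g x y \<or> adj g (entry h x) (entry h y)) edge_pairs"

text \<open>The map \<open>p\<close> runs from \<open>g'\<close> to \<open>g\<close>, so composing a
  representation by \<open>g\<close> with it yields one by \<open>g'\<close>.\<close>

definition isom :: "matrix \<Rightarrow> matrix \<Rightarrow> vertex row \<Rightarrow> bool" where
  "isom g g' p \<longleftrightarrow> 
     list_all (\<lambda>x. list_all (\<lambda>y. adj g' x y = adj g (entry p x) (entry p y)) vertices) vertices"

section \<open>Normal form: a homogeneous triple and a graph on four vertices\<close>

type_synonym quad = "bool \<times> bool \<times> bool \<times> bool"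
type_synonym sext = "bool \<times> bool \<times> bool \<times> bool \<times> bool \<times> bool"

text \<open>Only totality of this relation matters.\<close>

definition quad_le :: "quad \<Rightarrow> quad \<Rightarrow> bool" where
  "quad_le = (\<lambda>(a, b, c, d) (a', b', c', d'). (\<not> a \<and> a') \<or> (a = a' \<and>
     ((\<not> b \<and> b') \<or> (b = b' \<and> ((\<not> c \<and> c') \<or> (c = c' \<and> (\<not> d \<or> d')))))))"

text \<open>\<open>V0\<close> to \<open>V3\<close> carry the graph on four vertices, and
  \<open>V4\<close> to \<open>V6\<close> the triple, which is a clique or independent according to
  \<open>t\<close>. The quadruples are the rows joining the triple to the four.\<close>

definition block_matrix :: "bool \<Rightarrow> sext \<Rightarrow> quad \<Rightarrow> quad \<Rightarrow> quad \<Rightarrow> matrix" where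
  "block_matrix t = (\<lambda>(e01, e02, e03, e12, e13, e23) (a0, a1, a2, a3) (b0, b1, b2, b3) (c0, c1, c2, c3).
     Row (Row False e01 e02 e03 a0 b0 c0)
         (Row e01 False e12 e13 a1 b1 c1)
         (Row e02 e12 False e23 a2 b2 c2)
         (Row e03 e13 e23 False a3 b3 c3)
         (Row a0 a1 a2 a3 False t t)
         (Row b0 b1 b2 b3 t False t)
         (Row c0 c1 c2 c3 t t False))"

text \<open>
  The edges, in the order 01, 02, 03, 12, 13, 23, of the eleven graphs on four vertices.
\<close>

definition four_vertex_graphs :: "sext list" where
  "four_vertex_graphs = [
    (False, False, False, False, False, False),
    (True, False, False, False, False, False),
    (True, True, False, False, False, False),
    (True, True, True, False, False, False),
    (True, True, True, True, False, False),
    (True, True, True, True, True, False),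
    (True, True, True, True, True, True),
    (True, True, False, True, False, False),
    (True, True, False, False, True, False),
    (True, True, False, False, True, True),
    (True, False, False, False, False, True)]"

text \<open>
  Together with the foldings, enough non-injective folding_maps to rule out every candidate that is not a
  core; found by a greedy search for a small cover.
\<close>

definition folding_maps :: "vertex row list" where
  "folding_maps = [
    Row V0 V1 V2 V3 V1 V0 V3,
    Row V3 V4 V5 V5 V4 V3 V6,
    Row V0 V1 V2 V3 V1 V0 V2,
    Row V1 V4 V5 V6 V5 V1 V6,
    Row V0 V4 V5 V6 V5 V4 V6,
    Row V3 V4 V5 V4 V3 V5 V6,
    Row V4 V5 V2 V3 V4 V5 V6,
    Row V0 V2 V2 V5 V0 V5 V6,
    Row V0 V1 V2 V3 V2 V3 V6,
    Row V0 V1 V2 V1 V2 V5 V6,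
    Row V4 V1 V5 V3 V4 V5 V6,
    Row V0 V3 V4 V5 V3 V4 V6,
    Row V0 V1 V5 V6 V4 V5 V6,
    Row V4 V1 V2 V5 V4 V5 V6,
    Row V0 V1 V2 V3 V0 V1 V6,
    Row V0 V1 V0 V1 V4 V5 V6,
    Row V0 V2 V4 V5 V2 V5 V6,
    Row V0 V1 V1 V5 V0 V5 V6,
    Row V3 V4 V5 V6 V3 V5 V4,
    Row V1 V4 V5 V6 V5 V6 V1,
    Row V0 V4 V5 V6 V5 V6 V4,
    Row V0 V1 V2 V3 V0 V3 V1,
    Row V2 V3 V2 V3 V4 V5 V6,
    Row V0 V1 V1 V0 V6 V6 V6,
    Row V0 V1 V2 V1 V6 V6 V6,
    Row V2 V3 V3 V2 V4 V4 V4,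
    Row V0 V1 V2 V2 V5 V5 V6,
    Row V0 V2 V2 V0 V6 V6 V6,
    Row V0 V1 V1 V3 V5 V5 V6,
    Row V0 V1 V2 V6 V0 V5 V6,
    Row V0 V1 V6 V3 V4 V0 V6,
    Row V0 V1 V2 V2 V4 V6 V6,
    Row V0 V1 V2 V0 V1 V2 V1,
    Row V0 V6 V2 V3 V2 V3 V6,
    Row V0 V1 V4 V3 V4 V5 V1,
    Row V0 V1 V2 V4 V4 V1 V6]"

text \<open>The normal form is not canonical: the triple and the order of the other four vertices
  can be chosen in several ways. Hence the same core recurs, each time with its own witness for
  \<open>isom\<close>.\<close>

definition labelled_cores :: "(matrix \<times> vertex row) list" where
  "labelled_cores = [
    (core0, Row V0 V2 V3 V1 V6 V4 V5),
    (core0, Row V0 V3 V2 V1 V6 V4 V5),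
    (core1, Row V6 V5 V4 V0 V3 V1 V2),
    (core2, Row V0 V4 V1 V5 V2 V3 V6),
    (core4, Row V0 V5 V1 V4 V2 V3 V6),
    (core4, Row V0 V5 V2 V4 V1 V3 V6),
    (core3, Row V6 V1 V3 V2 V4 V0 V5),
    (core6, Row V1 V4 V0 V6 V3 V2 V5),
    (core5, Row V2 V6 V1 V3 V5 V0 V4),
    (core5, Row V1 V6 V2 V3 V5 V0 V4),
    (core2, Row V6 V0 V4 V1 V5 V2 V3),
    (core3, Row V1 V4 V0 V5 V2 V3 V6),
    (core3, Row V0 V4 V1 V5 V2 V3 V6),
    (core2, Row V4 V0 V5 V1 V6 V3 V2),
    (core3, Row V6 V0 V5 V1 V4 V2 V3),
    (core4, Row V2 V6 V0 V4 V1 V5 V3),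
    (core4, Row V3 V6 V0 V5 V1 V4 V2),
    (core4, Row V5 V0 V4 V1 V6 V2 V3),
    (core4, Row V4 V0 V5 V1 V6 V3 V2),
    (core5, Row V1 V5 V0 V4 V2 V3 V6),
    (core5, Row V0 V5 V1 V4 V2 V3 V6),
    (core5, Row V0 V5 V2 V4 V1 V6 V3),
    (core5, Row V1 V6 V2 V4 V0 V5 V3),
    (core6, Row V0 V5 V3 V2 V4 V1 V6),
    (core3, Row V1 V4 V0 V5 V3 V2 V6),
    (core3, Row V0 V4 V1 V5 V3 V2 V6),
    (core5, Row V1 V5 V0 V4 V3 V2 V6),
    (core5, Row V0 V5 V1 V4 V3 V2 V6),
    (core6, Row V0 V5 V2 V3 V4 V1 V6),
    (core5, Row V1 V6 V3 V4 V0 V5 V2),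
    (core5, Row V0 V5 V3 V4 V1 V6 V2),
    (core8, Row V0 V4 V1 V6 V3 V2 V5),
    (core8, Row V0 V4 V1 V6 V2 V3 V5),
    (core7, Row V0 V4 V2 V3 V5 V1 V6),
    (core7, Row V1 V4 V2 V3 V5 V0 V6),
    (core9, Row V0 V1 V2 V3 V4 V5 V6),
    (core4, Row V0 V5 V2 V3 V6 V1 V4),
    (core7, Row V0 V4 V1 V2 V3 V5 V6),
    (core6, Row V2 V5 V0 V4 V1 V6 V3),
    (core6, Row V1 V4 V0 V5 V2 V6 V3),
    (core6, Row V0 V4 V1 V5 V3 V6 V2),
    (core6, Row V0 V4 V2 V6 V3 V5 V1)]"

definition settled :: "matrix \<Rightarrow> bool" where
  "settled g \<longleftrightarrow> foldable g \<or> list_ex (is_endo g) folding_maps \<or>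
     list_ex (\<lambda>(g', p). isom g g' p) labelled_cores"

text \<open>Three vertices of which two lie in the clique are never independent. So this condition
  on the four vertices, with \<open>meets\<close> for each vertex of the clique, rules out all
  independent triples.\<close>

definition indep_free :: "sext \<Rightarrow> bool" where
  "indep_free = (\<lambda>(e01, e02, e03, e12, e13, e23).
     (e01 \<or> e02 \<or> e12) \<and> (e01 \<or> e03 \<or> e13) \<and> (e02 \<or> e03 \<or> e23) \<and> (e12 \<or> e13 \<or> e23))"

definition meets :: "sext \<Rightarrow> quad \<Rightarrow> bool" where
  "meets = (\<lambda>(e01, e02, e03, e12, e13, e23) (a0, a1, a2, a3).
     (e01 \<or> a0 \<or> a1) \<and> (e02 \<or> a0 \<or> a2) \<and> (e03 \<or> a0 \<or> a3) \<and>
     (e12 \<or> a1 \<or> a2) \<and> (e13 \<or> a1 \<or> a3) \<and> (e23 \<or> a2 \<or> a3))"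

definition corner :: "matrix \<Rightarrow> vertex row \<Rightarrow> sext" where
  "corner g p =
     (adj g (entry p V0) (entry p V1), adj g (entry p V0) (entry p V2),
      adj g (entry p V0) (entry p V3), adj g (entry p V1) (entry p V2),
      adj g (entry p V1) (entry p V3), adj g (entry p V2) (entry p V3))"

section \<open>Exhaustive checks\<close>

text \<open>Evaluation of all cases: ordering the rows leaves 816 triples of rows for each of the
  eleven graphs. Guards stand before the next quantifier, so that they prune the
  enumeration.\<close>

lemma settled_independent:
  "\<forall>e \<in> set four_vertex_graphs. \<forall>A B. \<not> quad_le A B \<or>
     (\<forall>C. \<not> quad_le B C \<or> settled (block_matrix False e A B C))"
  by code_simp

lemma settled_clique:
  "\<forall>e \<in> set four_vertex_graphs. \<not> indep_free e \<or>
     (\<forall>A. \<not> meets e A \<or> (\<forall>B. \<not> quad_le A B \<or> \<not> meets e B \<or>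
     (\<forall>C. \<not> quad_le B C \<or> \<not> meets e C \<or> settled (block_matrix True e A B C))))"
  by code_simp

text \<open>Runs through the 64 labelled graphs on four vertices. The equation of sets selects the
  permutations among the 256 maps; the rows to the triple are dummies.\<close>

lemma corner_in_four_vertex_graphs:
  "\<forall>e. list_ex (\<lambda>p. {entry p V0, entry p V1, entry p V2, entry p V3} = {V0, V1, V2, V3} \<and>
       corner (block_matrix False e (False, False, False, False) (False, False, False, False)
         (False, False, False, False)) p \<in> set four_vertex_graphs)
    [Row w x y z V4 V5 V6. w \<leftarrow> [V0, V1, V2, V3], x \<leftarrow> [V0, V1, V2, V3],
       y \<leftarrow> [V0, V1, V2, V3], z \<leftarrow> [V0, V1, V2, V3]]"
  by code_simp

lemma settled_independentD:
  assumes "e \<in> set four_vertex_graphs" "quad_le A B" "quad_le B C"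
  shows "settled (block_matrix False e A B C)"
  using settled_independent assms by metis

lemma settled_cliqueD:
  assumes "e \<in> set four_vertex_graphs" "indep_free e" "meets e A" "meets e B" "meets e C"
    and "quad_le A B" "quad_le B C"
  shows "settled (block_matrix True e A B C)"
  using settled_clique assms by metis

lemma four_vertex_graphs_complete:
  fixes E :: "'a \<Rightarrow> 'a \<Rightarrow> bool"
  assumes sym: "\<And>x y. E x y \<longleftrightarrow> E y x" and irrefl: "\<And>x. \<not> E x x"
  obtains s0 s1 s2 s3 where "{s0, s1, s2, s3} = {r0, r1, r2, r3}"
    and "(E s0 s1, E s0 s2, E s0 s3, E s1 s2, E s1 s3, E s2 s3) \<in> set four_vertex_graphs"
proof -
  let ?z = "(False, False, False, False)"
  let ?g = "block_matrix False (E r0 r1, E r0 r2, E r0 r3, E r1 r2, E r1 r3, E r2 r3) ?z ?z ?z"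
  \<comment> \<open>The last three entries are padding; only \<open>V0\<close> to \<open>V3\<close>
    are looked up.\<close>
  let ?\<rho> = "entry (Row r0 r1 r2 r3 r0 r0 r0)"
  let ?R = "{V0, V1, V2, V3}"
  have adj: "adj ?g x y \<longleftrightarrow> E (?\<rho> x) (?\<rho> y)" if "x \<in> ?R" "y \<in> ?R" for x y
    using that by (auto simp: adj_def block_matrix_def irrefl sym)
  obtain p where p: "{entry p V0, entry p V1, entry p V2, entry p V3} = ?R"
    and c: "corner ?g p \<in> set four_vertex_graphs"
    using corner_in_four_vertex_graphs[rule_format, of "(E r0 r1, E r0 r2, E r0 r3, E r1 r2, E r1 r3, E r2 r3)"]
    unfolding list_ex_iff by blast
  define s where "s x = ?\<rho> (entry p x)" for x
  have "{s V0, s V1, s V2, s V3} = ?\<rho> ` {entry p V0, entry p V1, entry p V2, entry p V3}"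
    by (simp add: s_def)
  also have "\<dots> = {r0, r1, r2, r3}" unfolding p by simp
  finally have "{s V0, s V1, s V2, s V3} = {r0, r1, r2, r3}" .
  moreover have "entry p V0 \<in> ?R" "entry p V1 \<in> ?R" "entry p V2 \<in> ?R" "entry p V3 \<in> ?R"
    using p by blast+
  then have "(E (s V0) (s V1), E (s V0) (s V2), E (s V0) (s V3), E (s V1) (s V2),
      E (s V1) (s V3), E (s V2) (s V3)) \<in> set four_vertex_graphs"
    using c unfolding corner_def s_def by (simp only: adj)
  ultimately show thesis using that by blast
qed

section \<open>From an abstract graph to its normal form\<close>

lemma UNIV_vertex: "UNIV = {V0, V1, V2, V3, V4, V5, V6}"
  using vertex.exhaust by blast

lemma inj_entry: "distinct (map (entry r) vertices) \<longleftrightarrow> inj (entry r)"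
proof -
  have "UNIV = set vertices" by auto
  moreover have "distinct vertices" by (simp add: vertices_def)
  ultimately show ?thesis by (simp only: distinct_map) simp
qed

lemma represents_block_matrix:
  fixes H :: "'a pair_pre_digraph"
  defines "E \<equiv> \<lambda>u v. (u, v) \<in> parcs H"
  assumes sym: "\<And>x y. E x y \<longleftrightarrow> E y x" and irrefl: "\<And>x. \<not> E x x"
    and V: "{r0, r1, r2, r3, u0, u1, u2} = pverts H" and card: "card (pverts H) = 7"
    and t: "E u0 u1 = t" "E u0 u2 = t" "E u1 u2 = t"
  shows "represents (entry (Row r0 r1 r2 r3 u0 u1 u2))
    (block_matrix t (E r0 r1, E r0 r2, E r0 r3, E r1 r2, E r1 r3, E r2 r3)
      (E u0 r0, E u0 r1, E u0 r2, E u0 r3) (E u1 r0, E u1 r1, E u1 r2, E u1 r3)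
      (E u2 r0, E u2 r1, E u2 r2, E u2 r3)) H" (is "represents ?\<phi> ?g H")
  unfolding represents_def
proof (intro conjI allI)
  have ran: "range ?\<phi> = pverts H" unfolding UNIV_vertex V[symmetric] by simp
  have "card (UNIV :: vertex set) = 7" by (simp add: UNIV_vertex)
  \<comment> \<open>Seven labels are mapped onto seven vertices, so no two images coincide.\<close>
  then have "inj ?\<phi>" using ran card by (intro eq_card_imp_inj_on) (auto simp: UNIV_vertex)
  with ran show "bij_betw ?\<phi> UNIV (pverts H)" by (simp add: bij_betw_def)
  have "adj ?g x y \<longleftrightarrow> E (?\<phi> x) (?\<phi> y)" for x y
    using t sym irrefl by (cases x; cases y) (auto simp: adj_def block_matrix_def)
  then show "adj ?g x y \<longleftrightarrow> (?\<phi> x, ?\<phi> y) \<in> parcs H" for x y by (simp add: E_def)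
qed

lemma ex_chain3:
  assumes "\<And>x y. le x y \<or> le y x"
  obtains u0 u1 u2 where "{u0, u1, u2} = {x, y, z}" "le u0 u1" "le u1 u2"
proof -
  have "le x y \<or> le y x" "le x z \<or> le z x" "le y z \<or> le z y" using assms by blast+
  then show thesis
    using that[of x y z] that[of x z y] that[of y x z] that[of y z x] that[of z x y] that[of z y x]
    by (auto simp: insert_commute)
qed

lemma quad_le_total: "quad_le A B \<or> quad_le B A"
  by (auto simp: quad_le_def)

text \<open>A vertex \<open>a\<close> is related in the same way to three of five others. Two of
  these three related to each other in that way too would form a homogeneous triple with
  \<open>a\<close>; otherwise the three are homogeneous themselves.\<close>

lemma ramsey_3_3:
  fixes E :: "'a \<Rightarrow> 'a \<Rightarrow> bool"
  assumes sym: "\<And>x y. E x y \<longleftrightarrow> E y x" and card: "card V \<ge> 6"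
    and no_indep: "\<And>x y z. {x, y, z} \<subseteq> V \<Longrightarrow> distinct [x, y, z] \<Longrightarrow> E x y \<or> E x z \<or> E y z"
  obtains x y z where "{x, y, z} \<subseteq> V" "distinct [x, y, z]" "E x y" "E x z" "E y z"
proof (rule ccontr)
  note clique = that
  assume *: "\<not> thesis"
  obtain W where W: "W \<subseteq> V" "card W = 6" using obtain_subset_with_card_n[OF card] by metis
  then obtain xs where xs: "set xs = W" "distinct xs"
    using finite_distinct_list[of W] by (metis card.infinite zero_neq_numeral)
  then have "length xs = 6" using W distinct_card by fastforce
  then obtain a b c d e f where xs_eq: "xs = [a, b, c, d, e, f]"
    by (auto simp: length_Suc_conv numeral_eq_Suc)
  have sub: "{a, b, c, d, e, f} \<subseteq> V" and dist: "distinct [a, b, c, d, e, f]"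
    using xs W by (auto simp: xs_eq)
  have 3: "(E x y \<or> E x z \<or> E y z) \<and> \<not> (E x y \<and> E x z \<and> E y z)"
    if "{x, y, z} \<subseteq> V" "distinct [x, y, z]" for x y z
    using no_indep[OF that] * clique[OF that] by blast
  define P where "P x y z \<longleftrightarrow> distinct [x, y, z] \<and> {x, y, z} \<subseteq> {b, c, d, e, f} \<and>
    E a x = E a y \<and> E a y = E a z" for x y z
  \<comment> \<open>Pigeonhole, over the ten triples among the five vertices other than
    \<open>a\<close>.\<close>
  have "P b c d \<or> P b c e \<or> P b c f \<or> P b d e \<or> P b d f \<or> P b e f \<or> P c d e \<or> P c d f \<or>
    P c e f \<or> P d e f"
    using dist by (simp add: P_def) argo
  then obtain x y z where "P x y z" by blast
  then have xyz: "distinct [x, y, z]" "{x, y, z} \<subseteq> {b, c, d, e, f}" "E a x = E a y" "E a y = E a z"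
    by (simp_all add: P_def)
  have "distinct [a, x, y, z]" "{a, x, y, z} \<subseteq> V" using xyz dist sub by auto
  then show False using 3[of a x y] 3[of a x z] 3[of a y z] 3[of x y z] xyz by auto
qed

lemma settled_representation:
  fixes H :: "'a pair_pre_digraph"
  assumes H: "pair_graph H" and card: "card (pverts H) = 7"
  obtains \<phi> g where "represents \<phi> g H" "settled g"
proof -
  interpret pair_graph H by fact
  define E where "E = (\<lambda>u v. (u, v) \<in> parcs H)"
  have sym: "E x y \<longleftrightarrow> E y x" for x y
    using pair_sym_arcs by (auto simp: E_def symmetric_def dest: symD)
  have irrefl: "\<not> E x x" for x using pair_no_loops by (force simp: E_def)
  let ?V = "pverts H"
  \<comment> \<open>A clique is taken only when no independent triple exists. The second fact keeps
    this for \<open>indep_free\<close> and \<open>meets\<close>.\<close>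
  obtain T t where T: "T \<subseteq> ?V" "card T = 3" "\<And>u v. u \<in> T \<Longrightarrow> v \<in> T \<Longrightarrow> u \<noteq> v \<Longrightarrow> E u v = t"
    and t: "\<And>x y z. t \<Longrightarrow> {x, y, z} \<subseteq> ?V \<Longrightarrow> distinct [x, y, z] \<Longrightarrow> E x y \<or> E x z \<or> E y z"
  proof (cases "\<exists>x y z. {x, y, z} \<subseteq> ?V \<and> distinct [x, y, z] \<and> \<not> (E x y \<or> E x z \<or> E y z)")
    case True
    then obtain x y z where "{x, y, z} \<subseteq> ?V" "distinct [x, y, z]" "\<not> E x y" "\<not> E x z" "\<not> E y z"
      by blast
    then show thesis using sym by (intro that[of "{x, y, z}" False]) auto
  next
    case False
    then have no_indep: "\<And>x y z. {x, y, z} \<subseteq> ?V \<Longrightarrow> distinct [x, y, z] \<Longrightarrow> E x y \<or> E x z \<or> E y z"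
      by blast
    obtain x y z where "{x, y, z} \<subseteq> ?V" "distinct [x, y, z]" "E x y" "E x z" "E y z"
      using ramsey_3_3[of E ?V, OF sym _ no_indep] card by auto
    then show thesis using sym no_indep by (intro that[of "{x, y, z}" True]) auto
  qed
  have "card (?V - T) = 4" using T card by (simp add: card_Diff_subset finite_subset)
  then obtain r0 r1 r2 r3 where R: "?V - T = {r0, r1, r2, r3}"
    by (auto simp: numeral_eq_Suc card_Suc_eq)
  obtain x y z where xyz: "T = {x, y, z}"
    using T(2) by (auto simp: numeral_eq_Suc card_Suc_eq)
  obtain s0 s1 s2 s3 where s: "{s0, s1, s2, s3} = ?V - T"
    and e: "(E s0 s1, E s0 s2, E s0 s3, E s1 s2, E s1 s3, E s2 s3) \<in> set four_vertex_graphs" (is "?e \<in> _")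
    using four_vertex_graphs_complete[of E r0 r1 r2 r3] sym irrefl R by metis
  define q where "q u = (E u s0, E u s1, E u s2, E u s3)" for u
  \<comment> \<open>The triple is homogeneous, so sorting it by rows leaves the rest of the matrix
    unchanged.\<close>
  obtain u0 u1 u2 where u: "{u0, u1, u2} = T" and le: "quad_le (q u0) (q u1)" "quad_le (q u1) (q u2)"
    using ex_chain3[of "\<lambda>u v. quad_le (q u) (q v)" x y z] quad_le_total xyz by metis
  have V: "{s0, s1, s2, s3, u0, u1, u2} = ?V" using s u T by blast
  have "card {s0, s1, s2, s3, u0, u1, u2} = 7" using card V by simp
  then have dist: "distinct [s0, s1, s2, s3, u0, u1, u2]"
    using card_distinct[of "[s0, s1, s2, s3, u0, u1, u2]"] by simp
  have tu: "E u0 u1 = t" "E u0 u2 = t" "E u1 u2 = t" using T(3) u dist by auto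
  let ?g = "block_matrix t ?e (q u0) (q u1) (q u2)"
  have "represents (entry (Row s0 s1 s2 s3 u0 u1 u2)) ?g H"
    unfolding q_def using represents_block_matrix[of H s0 s1 s2 s3 u0 u1 u2 t] sym irrefl V card tu
    unfolding E_def by blast
  moreover have "settled ?g"
  proof (cases t)
    case True
    note indep = t[OF True]
    have "indep_free ?e"
      using indep[of s0 s1 s2] indep[of s0 s1 s3] indep[of s0 s2 s3] indep[of s1 s2 s3] V dist
      by (auto simp: indep_free_def)
    moreover have "meets ?e (q u)" if "u \<in> {u0, u1, u2}" for u
    proof -
      have "E x y \<or> E u x \<or> E u y"
        if "x \<in> {s0, s1, s2, s3}" "y \<in> {s0, s1, s2, s3}" "x \<noteq> y" for x y
      proof -
        have "{x, y, u} \<subseteq> ?V" using that s u T(1) \<open>u \<in> _\<close> by blast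
        moreover have "distinct [x, y, u]" using that s u \<open>u \<in> _\<close> by auto
        ultimately show ?thesis using indep[of x y u] sym by blast
      qed
      then show ?thesis using dist by (simp add: meets_def q_def)
    qed
    ultimately have "settled (block_matrix True ?e (q u0) (q u1) (q u2))"
      using le by (intro settled_cliqueD[OF e]) simp_all
    then show ?thesis using True by simp
  next
    case False
    then show ?thesis using settled_independentD[OF e le] by simp
  qed
  ultimately show thesis using that by blast
qed

section \<open>What being a core excludes, and the conclusion\<close>

text \<open>Conjugation by \<open>\<phi>\<close> makes \<open>h\<close> an endomorphism of
  \<open>H\<close>, which is bijective on a core.\<close>

lemma core_endo_inj:
  assumes rep: "represents \<phi> g H" and core: "is_core H" and wf: "pair_graph H"
    and hom: "\<And>x y. adj g x y \<Longrightarrow> adj g (h x) (h y)"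
  shows "inj h"
proof -
  interpret pair_graph H by fact
  have bij: "bij_betw \<phi> UNIV (pverts H)" and adj: "\<And>x y. adj g x y \<longleftrightarrow> (\<phi> x, \<phi> y) \<in> parcs H"
    using rep by (auto simp: represents_def)
  have inj: "inj \<phi>" and ran: "range \<phi> = pverts H" using bij by (auto simp: bij_betw_def)
  let ?f = "\<lambda>u. \<phi> (h (inv \<phi> u))"
  have "graph_hom H H ?f"
    unfolding graph_hom_def
  proof (intro conjI ballI allI impI)
    show "?f u \<in> pverts H" for u using ran by blast
    fix u v assume uv: "(u, v) \<in> parcs H"
    then have "u \<in> range \<phi>" "v \<in> range \<phi>" using ran in_arcsD1 in_arcsD2 by blast+
    then have "adj g (inv \<phi> u) (inv \<phi> v)" using uv by (simp add: adj f_inv_into_f)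
    then show "(?f u, ?f v) \<in> parcs H" using hom adj by blast
  qed
  then have f: "inj_on ?f (pverts H)" using core by (auto simp: is_core_def bij_betw_def)
  show ?thesis
  proof (rule injI)
    fix x y assume "h x = h y"
    then have "?f (\<phi> x) = ?f (\<phi> y)" using inj by simp
    then have "\<phi> x = \<phi> y" using inj_onD[OF f, of "\<phi> x" "\<phi> y"] ran by blast
    then show "x = y" using inj by (simp add: inj_eq)
  qed
qed

lemma edge_pairsI:
  assumes "\<forall>(x, y) \<in> set edge_pairs. P x y" "\<And>x y. P x y \<Longrightarrow> P y x" "\<And>x. P x x"
  shows "P x y"
proof -
  have "(x, y) \<in> set edge_pairs \<or> (y, x) \<in> set edge_pairs \<or> x = y"
    by (cases x; cases y) (simp_all add: edge_pairs_def)
  then show ?thesis using assms by blast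
qed

lemma row_le_iff: "row_le r r' \<longleftrightarrow> (\<forall>z. entry r z \<longrightarrow> entry r' z)"
proof -
  have "(\<forall>z. P z) \<longleftrightarrow> P V0 \<and> P V1 \<and> P V2 \<and> P V3 \<and> P V4 \<and> P V5 \<and> P V6" for P
    using UNIV_vertex by (metis UNIV_I empty_iff insert_iff)
  then show ?thesis by (cases r; cases r') (simp only: entry.simps row_le.simps imp_conv_disj)
qed

lemma folding_maps_not_inj: "\<forall>h \<in> set folding_maps. \<not> distinct (map (entry h) vertices)"
  by code_simp

lemma labelled_cores_distinct: "\<forall>(g, p) \<in> set labelled_cores. distinct (map (entry p) vertices)"
  by code_simp

lemma labelled_cores_certified: "\<forall>(g, p) \<in> set labelled_cores. \<exists>c. certified g c"
  using certified_cores[THEN exI[where P = "certified _"]]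
  by (simp add: labelled_cores_def del: split_paired_Ex)

theorem theorem5p13:
  fixes H :: "'a pair_pre_digraph"
  assumes "pair_graph H"
    and "card (pverts H) = 7"
    and "is_core H"
  shows "projective H"
proof -
  interpret pair_graph H by fact
  obtain \<phi> g where rep: "represents \<phi> g H" and "settled g"
    using settled_representation assms(1,2) by blast
  have adj: "\<And>x y. adj g x y \<longleftrightarrow> (\<phi> x, \<phi> y) \<in> parcs H" using rep by (simp add: represents_def)
  have sym: "adj g x y \<Longrightarrow> adj g y x" for x y
    using pair_sym_arcs by (auto simp: adj symmetric_def dest: symD)
  have irrefl: "\<not> adj g x x" for x using pair_no_loops by (force simp: adj)
  note endo_inj = core_endo_inj[OF rep assms(3,1)]
  have no_fold: "\<not> row_le (entry g x) (entry g y)" if "x \<noteq> y" for x y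
  proof
    assume "row_le (entry g x) (entry g y)"
    then have le: "adj g y z" if "adj g x z" for z using that by (simp add: row_le_iff adj_def)
    \<comment> \<open>Edges at \<open>x\<close> move to \<open>y\<close> by the inclusion of
      neighbourhoods, and no edge has both ends at \<open>x\<close>.\<close>
    have "adj g (if u = x then y else u) (if v = x then y else v)" if "adj g u v" for u v
      using that le[of v] le[of u] sym[of u v] sym[of y u] irrefl[of x] by auto
    then have "inj (\<lambda>u. if u = x then y else u)" by (rule endo_inj)
    from injD[OF this, of x y] show False using \<open>x \<noteq> y\<close> by simp
  qed
  have "\<not> foldable g"
  proof
    assume "foldable g"
    then obtain x y where xy: "(x, y) \<in> set edge_pairs"
      and le: "row_le (entry g x) (entry g y) \<or> row_le (entry g y) (entry g x)"
      unfolding foldable_def list_ex_iff by blast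
    have "x \<noteq> y" using xy by (auto simp: edge_pairs_def)
    then show False using le no_fold[of x y] no_fold[of y x] by simp
  qed
  moreover have "\<not> is_endo g h" if "h \<in> set folding_maps" for h
  proof
    assume "is_endo g h"
    then have "\<forall>(x, y) \<in> set edge_pairs. adj g x y \<longrightarrow> adj g (entry h x) (entry h y)"
      unfolding is_endo_def list_all_iff by blast
    \<comment> \<open>Each pair is listed in one order only; symmetry gives the other order and
      irreflexivity the diagonal.\<close>
    then have "adj g x y \<longrightarrow> adj g (entry h x) (entry h y)" for x y
      by (rule edge_pairsI) (use sym irrefl in blast)+
    then have "inj (entry h)" by (intro endo_inj) blast
    then show False using folding_maps_not_inj that by (simp add: inj_entry)
  qed
  ultimately obtain g' p where labelled_cores: "(g', p) \<in> set labelled_cores" and "isom g g' p"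
    using \<open>settled g\<close> unfolding settled_def list_ex_iff by blast
  have p: "bij (entry p)"
  proof -
    have "inj (entry p)" using labelled_cores_distinct labelled_cores inj_entry by blast
    moreover have "finite (UNIV :: vertex set)" by (simp add: UNIV_vertex)
    ultimately show ?thesis by (simp add: bij_def finite_UNIV_inj_surj)
  qed
  \<comment> \<open>The certificate belongs to \<open>g'\<close> and not to \<open>g\<close>, so the
    representation is pulled back along \<open>p\<close>.\<close>
  have "bij_betw (\<phi> \<circ> entry p) UNIV (pverts H)"
    using rep bij_betw_trans[OF p] unfolding represents_def by blast
  moreover have "adj g' x y \<longleftrightarrow> (\<phi> (entry p x), \<phi> (entry p y)) \<in> parcs H" for x y
    using \<open>isom g g' p\<close> by (simp add: isom_def list_all_iff adj)
  ultimately have "represents (\<phi> \<circ> entry p) g' H" by (simp add: represents_def)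
  then show ?thesis using labelled_cores_certified labelled_cores projective_if_certified by blast
qed

end
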